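(* Let $K$ be a strongly connected simplicial complex, $a(K)$ its anti-prismatic subdivision and $f:a(K)\to K$ the crumpling map. The induced map $f_*:\Pi(a(K))\to\Pi(K)$ is an isomorphism of permutation groups.
   Context: $K$ is a locally finite simplicial complex, pure of dimension $d$ (every face lies in a $d$-dimensional face). $d$-dimensional faces are facets, codimension-$1$ faces are ridges; two distinct facets are neighbors if they share a ridge; $V(\sigma)$ is the vertex set of $\sigma$. $K$ is strongly connected if any two facets are joined by a facet path, i.e. a sequence of facets with consecutive ones neighbors. For neighboring facets $\sigma,\tau$ the perspectivity $\langle\sigma,\tau\rangle:V(\sigma)\to V(\tau)$ is the bijection fixing all common vertices and sending the vertex of $\sigma$ not in $\tau$ to the vertex of $\tau$ not in $\sigma$. For a facet path $\gamma=(\sigma_0,\dots,\sigma_n)$ the projectivity along $\gamma$ is $\langle\gamma\rangle=\langle\sigma_0,\sigma_1\rangle\cdots\langle\sigma_{n-1},\sigma_n\rangle$ (maps composed left to right). The projectivities along closed facet paths based at $\sigma_0$ form the group of projectivities $\Pi(K,\sigma_0)\le\operatorname{Sym}(V(\sigma_0))$; for strongly connected $K$ it is, up to conjugation in $S_{d+1}$, independent of $\sigma_0$ and denoted $\Pi(K)$. Anti-prismatic subdivision. $a(K)$ is the simplicial complex whose vertices are all pairs $(\tau,w)$, where $\tau$ is a non-empty face of $K$ and $w$ a vertex of $\tau$ (a vertex $w$ of $K$ is identified with $(w,w)$); a finite set of such pairs is a face if and only if it can be written as $\{(\tau_0,w_0),\dots,(\tau_k,w_k)\}$ with $\tau_0\subseteq\tau_1\subseteq\dots\subseteq\tau_k$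 (repetitions allowed) and such that $\tau_i\subsetneq\tau_j$ implies $w_j\notin\tau_i$. The crumpling map $f:a(K)\to K$, $(\tau,w)\mapsto w$, is a non-degenerate simplicial map (it takes each simplex to a simplex of the same dimension). For a facet $\sigma_0'$ of $a(K)$ and the facet $\sigma_0=f(\sigma_0')$ of $K$, the induced homomorphism $f_*:\Pi(a(K),\sigma_0')\to\Pi(K,\sigma_0)$ is $g\mapsto f^{-1}gf$, where $f$ also denotes the bijection $V(\sigma_0')\to V(\sigma_0)$ and maps are composed left to right. *)

theory Defs
  imports Main "HOL-Algebra.Bij"
begin

text \<open>
  A simplicial complex is given by its set of faces; the empty set counts as a face (of
  dimension \<open>-1\<close>), and a face of dimension \<open>d\<close> is one with \<open>d + 1\<close> vertices. Since a face is
  its own vertex set, \<open>V(\<sigma>)\<close> is just \<open>\<sigma>\<close>.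
\<close>

definition abstract_complex :: "'a set set \<Rightarrow> bool" where
  "abstract_complex K \<longleftrightarrow>
     {} \<in> K \<and> (\<forall>\<sigma>\<in>K. finite \<sigma>) \<and> (\<forall>\<sigma>\<in>K. \<forall>\<rho>. \<rho> \<subseteq> \<sigma> \<longrightarrow> \<rho> \<in> K)"

definition locally_finite_complex :: "'a set set \<Rightarrow> bool" where
  "locally_finite_complex K \<longleftrightarrow> (\<forall>v. finite {\<sigma>\<in>K. v \<in> \<sigma>})"

definition facets :: "nat \<Rightarrow> 'a set set \<Rightarrow> 'a set set" where
  "facets d K = {\<sigma>\<in>K. card \<sigma> = d + 1}"

definition ridges :: "nat \<Rightarrow> 'a set set \<Rightarrow> 'a set set" where
  "ridges d K = {\<rho>\<in>K. card \<rho> = d}"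

definition pure_complex :: "nat \<Rightarrow> 'a set set \<Rightarrow> bool" where
  "pure_complex d K \<longleftrightarrow>
     (\<forall>\<rho>\<in>K. card \<rho> \<le> d + 1) \<and> (\<forall>\<rho>\<in>K. \<exists>\<sigma>\<in>facets d K. \<rho> \<subseteq> \<sigma>)"

definition neighbors :: "nat \<Rightarrow> 'a set set \<Rightarrow> 'a set \<Rightarrow> 'a set \<Rightarrow> bool" where
  "neighbors d K \<sigma> \<tau> \<longleftrightarrow>
     \<sigma> \<in> facets d K \<and> \<tau> \<in> facets d K \<and> \<sigma> \<noteq> \<tau> \<and> (\<exists>\<rho>\<in>ridges d K. \<rho> \<subseteq> \<sigma> \<and> \<rho> \<subseteq> \<tau>)"

definition facet_path :: "nat \<Rightarrow> 'a set set \<Rightarrow> 'a set list \<Rightarrow> bool" where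
  "facet_path d K \<gamma> \<longleftrightarrow>
     \<gamma> \<noteq> [] \<and> set \<gamma> \<subseteq> facets d K \<and> successively (neighbors d K) \<gamma>"

definition strongly_connected :: "nat \<Rightarrow> 'a set set \<Rightarrow> bool" where
  "strongly_connected d K \<longleftrightarrow>
     (\<forall>\<sigma>\<in>facets d K. \<forall>\<tau>\<in>facets d K. \<exists>\<gamma>. facet_path d K \<gamma> \<and> hd \<gamma> = \<sigma> \<and> last \<gamma> = \<tau>)"

text \<open>
  Maps between vertex sets are extensional functions (\<open>undefined\<close> outside their domain), as
  in \<open>HOL-Algebra.Bij\<close>, so that equality of functions is equality of maps.
\<close>

definition perspectivity :: "'a set \<Rightarrow> 'a set \<Rightarrow> 'a \<Rightarrow> 'a" where
  "perspectivity \<sigma> \<tau> = (\<lambda>v\<in>\<sigma>. if v \<in> \<tau> then v else the_elem (\<tau> - \<sigma>))"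

fun projectivity :: "'a set list \<Rightarrow> 'a \<Rightarrow> 'a" where
  "projectivity [] = undefined"
| "projectivity [\<sigma>] = (\<lambda>v\<in>\<sigma>. v)"
| "projectivity (\<sigma> # \<tau> # \<gamma>) = compose \<sigma> (projectivity (\<tau> # \<gamma>)) (perspectivity \<sigma> \<tau>)"

text \<open>The symmetric group with maps composed from left to right, i.e. opposite to \<open>BijGroup\<close>.\<close>

definition Sym :: "'a set \<Rightarrow> ('a \<Rightarrow> 'a) monoid" where
  "Sym S = (BijGroup S)\<lparr>mult := (\<lambda>g h. h \<otimes>\<^bsub>BijGroup S\<^esub> g)\<rparr>"

definition projectivities :: "nat \<Rightarrow> 'a set set \<Rightarrow> 'a set \<Rightarrow> ('a \<Rightarrow> 'a) set" where
  "projectivities d K \<sigma> =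
     {projectivity \<gamma> |\<gamma>. facet_path d K \<gamma> \<and> hd \<gamma> = \<sigma> \<and> last \<gamma> = \<sigma>}"

text \<open>
  An isomorphism of permutation groups \<open>G \<le> Sym X\<close> and \<open>H \<le> Sym Y\<close> is a group isomorphism \<open>\<phi>\<close>
  together with a bijection \<open>b\<close> of the underlying sets that intertwines the actions.
\<close>

definition perm_group_iso ::
    "'a set \<Rightarrow> ('a \<Rightarrow> 'a) set \<Rightarrow> 'b set \<Rightarrow> ('b \<Rightarrow> 'b) set
      \<Rightarrow> ('a \<Rightarrow> 'b) \<Rightarrow> (('a \<Rightarrow> 'a) \<Rightarrow> ('b \<Rightarrow> 'b)) \<Rightarrow> bool" where
  "perm_group_iso X G Y H b \<phi> \<longleftrightarrow>
     subgroup G (Sym X) \<and> subgroup H (Sym Y) \<and> bij_betw b X Y \<and>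
     \<phi> \<in> iso ((Sym X)\<lparr>carrier := G\<rparr>) ((Sym Y)\<lparr>carrier := H\<rparr>) \<and>
     (\<forall>g\<in>G. \<forall>x\<in>X. \<phi> g (b x) = b (g x))"

definition antiprism_vertices :: "'a set set \<Rightarrow> ('a set \<times> 'a) set" where
  "antiprism_vertices K = {(\<tau>, w). \<tau> \<in> K \<and> w \<in> \<tau>}"

text \<open>
  The anti-prismatic subdivision \<open>a(K)\<close>. The list enumerates a face along the chain
  \<open>\<tau>\<^sub>0 \<subseteq> \<dots> \<subseteq> \<tau>\<^sub>k\<close>; the empty list yields the empty face. The vertex \<open>w\<close> of \<open>K\<close> corresponds to
  \<open>({w}, w)\<close>.
\<close>

definition antiprism :: "'a set set \<Rightarrow> ('a set \<times> 'a) set set" where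
  "antiprism K =
     {set ps |ps. set ps \<subseteq> antiprism_vertices K \<and>
        sorted_wrt (\<lambda>p q. fst p \<subseteq> fst q) ps \<and>
        (\<forall>p\<in>set ps. \<forall>q\<in>set ps. fst p \<subset> fst q \<longrightarrow> snd q \<notin> fst p)}"

definition crumpling :: "'a set \<times> 'a \<Rightarrow> 'a" where
  "crumpling = (\<lambda>(\<tau>, w). w)"

text \<open>
  The homomorphism \<open>g \<mapsto> f\<^sup>-\<^sup>1 g f\<close> induced by \<open>f\<close>, bijective on the vertices of \<open>\<sigma>'\<close>; reading
  from left to right, \<open>f\<^sup>-\<^sup>1\<close> is applied first.
\<close>

definition induced_map :: "('b \<Rightarrow> 'a) \<Rightarrow> 'b set \<Rightarrow> ('b \<Rightarrow> 'b) \<Rightarrow> 'a \<Rightarrow> 'a" where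
  "induced_map f \<sigma>' g = (\<lambda>v\<in>f ` \<sigma>'. f (g (inv_into \<sigma>' f v)))"

end

theory Submission
  imports Defs "HOL-Library.Product_Lexorder"
begin

text \<open>
  A facet of \<open>a(K)\<close> is a facet \<open>\<sigma>\<close> of \<open>K\<close> with an ordered partition of its vertices, that is, with
  a ranking \<open>r\<close> of \<open>\<sigma>\<close>: its vertices are the pairs \<open>({u\<in>\<sigma>. r u \<le> r v}, v)\<close> for \<open>v \<in> \<sigma>\<close>
  (\<open>flag_facet\<close>), and the faces of \<open>a(K)\<close> are the subsets of such families for faces \<open>\<sigma>\<close> of \<open>K\<close>.
  That \<open>a(K)\<close> is a locally finite pure complex is read off from this description.

  Pushing forward (\<open>crumpling_projects\<close>): since crumpling is injective on faces, two neighboring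
  facets of \<open>a(K)\<close> either lie over the same facet of \<open>K\<close>, and then their perspectivity preserves
  the labels, or lie over neighboring facets, and then their perspectivity covers the one in \<open>K\<close>.
  So every projectivity of \<open>a(K)\<close> covers one of \<open>K\<close>. A permutation of the vertices of a facet
  \<open>\<sigma>'\<close> is determined by the permutation of the labels; this gives injectivity of \<open>f\<^sub>*\<close>.

  Lifting (\<open>lift_projects\<close>): neighbors \<open>\<sigma>\<close>, \<open>\<tau>\<close> lift to the neighbors that carry the ordered
  partitions with first block \<open>\<sigma> \<inter> \<tau>\<close> and the remaining vertex as second block. To compose such
  lifts, any two facets over one \<open>\<sigma>\<close> have to be joined by a facet path that stays over \<open>\<sigma>\<close>; its
  projectivity then preserves labels (\<open>fibre_linked_same_image\<close>). This holds since splitting one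
  vertex off the front of a block changes only one vertex of the facet in \<open>a(K)\<close>. Such splittings
  refine every ordered partition to one with singleton blocks, and the latter is also a
  refinement of the partition with one block. Lifting yields both surjectivity of \<open>f\<^sub>*\<close> and strong
  connectedness of \<open>a(K)\<close>.
\<close>

section \<open>Projectivities without lists\<close>

text \<open>
  All arguments about facet paths are inductions along the path in which only the two end facets
  and the resulting map matter, so the path itself is hidden.
\<close>

inductive projects :: "nat \<Rightarrow> 'a set set \<Rightarrow> 'a set \<Rightarrow> 'a set \<Rightarrow> ('a \<Rightarrow> 'a) \<Rightarrow> bool"
  for d :: nat and K :: "'a set set" where
  single: "\<sigma> \<in> facets d K \<Longrightarrow> projects d K \<sigma> \<sigma> (\<lambda>v\<in>\<sigma>. v)"
| step: "neighbors d K \<sigma> \<tau> \<Longrightarrow> projects d K \<tau> \<rho> g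
          \<Longrightarrow> projects d K \<sigma> \<rho> (compose \<sigma> g (perspectivity \<sigma> \<tau>))"

lemma projects_iff:
  "projects d K \<sigma> \<tau> g \<longleftrightarrow>
     (\<exists>\<gamma>. facet_path d K \<gamma> \<and> hd \<gamma> = \<sigma> \<and> last \<gamma> = \<tau> \<and> projectivity \<gamma> = g)"
proof
  assume "projects d K \<sigma> \<tau> g"
  then show "\<exists>\<gamma>. facet_path d K \<gamma> \<and> hd \<gamma> = \<sigma> \<and> last \<gamma> = \<tau> \<and> projectivity \<gamma> = g"
  proof induction
    case (single \<sigma>)
    then show ?case by (intro exI[of _ "[\<sigma>]"]) (auto simp: facet_path_def)
  next
    case (step \<sigma> \<tau> \<rho> g)
    then obtain \<gamma> where \<gamma>: "facet_path d K \<gamma>" "hd \<gamma> = \<tau>" "last \<gamma> = \<rho>" "projectivity \<gamma> = g"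
      by blast
    then obtain \<gamma>' where "\<gamma> = \<tau> # \<gamma>'"
      by (cases \<gamma>) (auto simp: facet_path_def)
    with \<gamma> step.hyps show ?case
      by (intro exI[of _ "\<sigma> # \<gamma>"]) (auto simp: facet_path_def neighbors_def)
  qed
next
  have "projects d K (hd \<gamma>) (last \<gamma>) (projectivity \<gamma>)" if "facet_path d K \<gamma>" for \<gamma>
    using that
  proof (induction \<gamma> rule: projectivity.induct)
    case 1
    then show ?case by (simp add: facet_path_def)
  next
    case (2 \<sigma>)
    then have "\<sigma> \<in> facets d K" by (simp add: facet_path_def)
    from projects.single[OF this] show ?case by (simp del: restrict_apply)
  next
    case (3 \<sigma> \<tau> \<gamma>)
    then have "facet_path d K (\<tau> # \<gamma>)" "neighbors d K \<sigma> \<tau>" by (auto simp: facet_path_def)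
    then show ?case using 3(1) by (simp add: projects.step)
  qed
  then show "\<exists>\<gamma>. facet_path d K \<gamma> \<and> hd \<gamma> = \<sigma> \<and> last \<gamma> = \<tau> \<and> projectivity \<gamma> = g
      \<Longrightarrow> projects d K \<sigma> \<tau> g"
    by blast
qed

lemma projectivities_eq: "projectivities d K \<sigma> = {g. projects d K \<sigma> \<sigma> g}"
  by (simp add: projectivities_def projects_iff conj_ac eq_commute)

lemma strongly_connected_iff:
  "strongly_connected d K \<longleftrightarrow> (\<forall>\<sigma>\<in>facets d K. \<forall>\<tau>\<in>facets d K. \<exists>g. projects d K \<sigma> \<tau> g)"
  by (simp add: strongly_connected_def projects_iff)

lemma neighbors_sym: "neighbors d K \<sigma> \<tau> \<Longrightarrow> neighbors d K \<tau> \<sigma>"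
  unfolding neighbors_def by blast

lemma facets_finite: "\<sigma> \<in> facets d K \<Longrightarrow> finite \<sigma>"
  unfolding facets_def by (auto intro: card_ge_0_finite)

lemma neighborsE:
  assumes "neighbors d K \<sigma> \<tau>" and "abstract_complex K"
  obtains \<rho> x y where "\<rho> \<in> K" "finite \<rho>" "card \<rho> = d" "x \<notin> \<rho>" "y \<notin> \<rho>" "x \<noteq> y"
    "\<sigma> = insert x \<rho>" "\<tau> = insert y \<rho>"
proof -
  obtain \<rho> where \<rho>: "\<rho> \<in> K" "card \<rho> = d" "\<rho> \<subseteq> \<sigma>" "\<rho> \<subseteq> \<tau>"
    and s: "card \<sigma> = Suc d" "card \<tau> = Suc d" "\<sigma> \<noteq> \<tau>"
    using assms(1) unfolding neighbors_def ridges_def facets_def by auto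
  have fin: "finite \<rho>" "finite \<sigma>" "finite \<tau>"
    using \<rho>(1) s assms(2) by (simp_all add: abstract_complex_def card_ge_0_finite)
  have "card (\<sigma> - \<rho>) = 1" "card (\<tau> - \<rho>) = 1"
    using \<rho> s fin by (simp_all add: card_Diff_subset)
  then obtain x y where "\<sigma> - \<rho> = {x}" "\<tau> - \<rho> = {y}"
    by (auto simp: card_1_singleton_iff)
  then have "x \<notin> \<rho>" "y \<notin> \<rho>" "\<sigma> = insert x \<rho>" "\<tau> = insert y \<rho>"
    using \<rho> by auto
  with that[of \<rho> x y] \<rho> s fin show ?thesis by auto
qed

lemma perspectivity_insert:
  assumes "x \<notin> \<rho>" "y \<notin> \<rho>" "x \<noteq> y"
  shows "perspectivity (insert x \<rho>) (insert y \<rho>) = (\<lambda>v\<in>insert x \<rho>. if v = x then y else v)"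
proof -
  have "insert y \<rho> - insert x \<rho> = {y}" using assms by auto
  then show ?thesis using assms by (auto simp: perspectivity_def fun_eq_iff restrict_def)
qed

lemma perspectivity_inverse:
  assumes "neighbors d K \<sigma> \<tau>" "abstract_complex K" "v \<in> \<sigma>"
  shows "perspectivity \<tau> \<sigma> (perspectivity \<sigma> \<tau> v) = v"
  using assms(1,2)
proof (rule neighborsE)
  fix \<rho> x y
  assume h: "x \<notin> \<rho>" "y \<notin> \<rho>" "x \<noteq> y" "\<sigma> = insert x \<rho>" "\<tau> = insert y \<rho>"
  then show ?thesis
    using assms(3) perspectivity_insert[of x \<rho> y] perspectivity_insert[of y \<rho> x] by auto
qed

lemma perspectivity_bij:
  assumes "neighbors d K \<sigma> \<tau>" "abstract_complex K"
  shows "bij_betw (perspectivity \<sigma> \<tau>) \<sigma> \<tau>"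
  using assms(1,2)
proof (rule neighborsE)
  fix \<rho> x y
  assume h: "x \<notin> \<rho>" "y \<notin> \<rho>" "x \<noteq> y" "\<sigma> = insert x \<rho>" "\<tau> = insert y \<rho>"
  then show ?thesis
    using perspectivity_insert[of x \<rho> y] by (auto simp: bij_betw_def inj_on_def)
qed

lemma projects_extensional: "projects d K \<sigma> \<tau> g \<Longrightarrow> g \<in> extensional \<sigma>"
  by (induction rule: projects.induct) (simp_all add: compose_def del: restrict_apply)

lemma projects_bij:
  assumes "projects d K \<sigma> \<tau> g" "abstract_complex K"
  shows "bij_betw g \<sigma> \<tau>"
  using assms
proof (induction rule: projects.induct)
  case (single \<sigma>)
  then show ?case by (simp add: bij_betw_def inj_on_def)
next
  case (step \<sigma> \<tau> \<rho> g)
  then show ?case by (metis bij_betw_compose perspectivity_bij)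
qed

lemma projects_trans:
  assumes "projects d K \<sigma> \<tau> g" "projects d K \<tau> \<rho> h" "abstract_complex K"
  shows "projects d K \<sigma> \<rho> (compose \<sigma> h g)"
  using assms
proof (induction rule: projects.induct)
  case (single \<sigma>)
  have "compose \<sigma> h (\<lambda>v\<in>\<sigma>. v) = h"
    using projects_extensional[OF single(2)]
    by (auto simp: compose_def fun_eq_iff restrict_def extensional_def)
  with single show ?case by (simp del: restrict_apply)
next
  case (step \<sigma> \<tau> \<tau>' g)
  have "compose \<sigma> h (compose \<sigma> g (perspectivity \<sigma> \<tau>))
      = compose \<sigma> (compose \<tau> h g) (perspectivity \<sigma> \<tau>)"
    using perspectivity_bij[OF step(1) step(5)]
    by (auto simp: compose_def fun_eq_iff bij_betw_def)
  with step show ?case by (auto intro: projects.step)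
qed

lemma projects_neighbors:
  assumes "neighbors d K \<sigma> \<tau>" "abstract_complex K"
  shows "projects d K \<sigma> \<tau> (perspectivity \<sigma> \<tau>)"
proof -
  have "compose \<sigma> (\<lambda>v\<in>\<tau>. v) (perspectivity \<sigma> \<tau>) = perspectivity \<sigma> \<tau>"
    using perspectivity_bij[OF assms]
    by (auto simp: compose_def fun_eq_iff bij_betw_def perspectivity_def restrict_def)
  moreover have "\<tau> \<in> facets d K" using assms(1) by (simp add: neighbors_def)
  ultimately show ?thesis
    using projects.step[OF assms(1) projects.single] by auto
qed

lemma projects_inverse:
  assumes "projects d K \<sigma> \<tau> g" "abstract_complex K"
  shows "\<exists>h. projects d K \<tau> \<sigma> h \<and> (\<forall>v\<in>\<sigma>. h (g v) = v)"
  using assms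
proof (induction rule: projects.induct)
  case (single \<sigma>)
  have "\<forall>v\<in>\<sigma>. (\<lambda>v\<in>\<sigma>. v) ((\<lambda>v\<in>\<sigma>. v) v) = v" by simp
  with projects.single[OF single(1)] show ?case by blast
next
  case (step \<sigma> \<tau> \<rho> g)
  then obtain h where h: "projects d K \<rho> \<tau> h" "\<forall>v\<in>\<tau>. h (g v) = v" by blast
  have "projects d K \<rho> \<sigma> (compose \<rho> (perspectivity \<tau> \<sigma>) h)"
    using h(1) step by (blast intro: projects_trans projects_neighbors neighbors_sym)
  moreover have "compose \<rho> (perspectivity \<tau> \<sigma>) h (compose \<sigma> g (perspectivity \<sigma> \<tau>) v) = v"
    if "v \<in> \<sigma>" for v
    using that h(2) perspectivity_inverse[OF step(1) step(4) that]
      bij_betwE[OF perspectivity_bij[OF step(1) step(4)]]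
      bij_betwE[OF projects_bij[OF step(2) step(4)]]
    by (auto simp: compose_def)
  ultimately show ?case by blast
qed

lemma group_Sym: "group (Sym S)"
proof -
  interpret B: group "BijGroup S" by (rule group_BijGroup)
  show ?thesis
    by (rule groupI) (auto simp: Sym_def B.m_assoc intro: B.r_inv)
qed

lemma carrier_Sym: "carrier (Sym S) = Bij S"
  and one_Sym: "\<one>\<^bsub>Sym S\<^esub> = (\<lambda>x\<in>S. x)"
  by (simp_all add: Sym_def BijGroup_def)

lemma mult_Sym: "g \<in> Bij S \<Longrightarrow> h \<in> Bij S \<Longrightarrow> g \<otimes>\<^bsub>Sym S\<^esub> h = compose S h g"
  by (simp add: Sym_def BijGroup_def)

lemma projectivities_subset_Bij:
  "abstract_complex K \<Longrightarrow> projectivities d K \<sigma> \<subseteq> Bij \<sigma>"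
  by (auto simp: projectivities_eq Bij_def projects_bij projects_extensional)

text \<open>
  Closure under inverses comes from reversing facet paths, closure under products from
  concatenating them.
\<close>

lemma projectivities_subgroup:
  assumes "abstract_complex K" "\<sigma> \<in> facets d K"
  shows "subgroup (projectivities d K \<sigma>) (Sym \<sigma>)"
proof -
  interpret G: group "Sym \<sigma>" by (rule group_Sym)
  note sub = projectivities_subset_Bij[OF assms(1), of d \<sigma>]
  show ?thesis
  proof (rule G.subgroupI)
    show "projectivities d K \<sigma> \<subseteq> carrier (Sym \<sigma>)" using sub by (simp add: carrier_Sym)
    show "projectivities d K \<sigma> \<noteq> {}"
      using projects.single[OF assms(2)] by (auto simp: projectivities_eq)
  next
    fix g assume g: "g \<in> projectivities d K \<sigma>"
    then have "projects d K \<sigma> \<sigma> g" by (simp add: projectivities_eq)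
    from projects_inverse[OF this assms(1)]
    obtain h where h: "projects d K \<sigma> \<sigma> h" "\<forall>v\<in>\<sigma>. h (g v) = v" by blast
    then have hg: "h \<in> Bij \<sigma>" "g \<in> Bij \<sigma>" using sub g by (auto simp: projectivities_eq)
    then have "g \<otimes>\<^bsub>Sym \<sigma>\<^esub> h = \<one>\<^bsub>Sym \<sigma>\<^esub>"
      using h(2) by (auto simp: mult_Sym one_Sym compose_def fun_eq_iff)
    then have "inv\<^bsub>Sym \<sigma>\<^esub> g = h"
      using hg by (metis G.inv_equality G.inv_inv carrier_Sym)
    then show "inv\<^bsub>Sym \<sigma>\<^esub> g \<in> projectivities d K \<sigma>"
      using h(1) by (simp add: projectivities_eq)
  next
    fix g h assume "g \<in> projectivities d K \<sigma>" "h \<in> projectivities d K \<sigma>"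
    with sub show "g \<otimes>\<^bsub>Sym \<sigma>\<^esub> h \<in> projectivities d K \<sigma>"
      using projects_trans[OF _ _ assms(1)] by (auto simp: projectivities_eq mult_Sym subset_iff)
  qed
qed

section \<open>Faces of the anti-prismatic subdivision\<close>

text \<open>
  The ordered partition of \<open>\<sigma>\<close> is given by the level sets of \<open>r\<close>. The codomain is an arbitrary
  linear order so that partitions can be refined by lexicographic ranks.
\<close>

definition flag_facet :: "'a set \<Rightarrow> ('a \<Rightarrow> 'b::linorder) \<Rightarrow> ('a set \<times> 'a) set" where
  "flag_facet \<sigma> r = (\<lambda>v. ({u\<in>\<sigma>. r u \<le> r v}, v)) ` \<sigma>"

lemma crumpling_flag_facet: "crumpling ` flag_facet \<sigma> r = \<sigma>"
  by (force simp: flag_facet_def crumpling_def)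

lemma crumpling_inj_flag_facet: "inj_on crumpling (flag_facet \<sigma> r)"
  by (auto simp: flag_facet_def crumpling_def inj_on_def)

lemma card_flag_facet: "card (flag_facet \<sigma> r) = card \<sigma>"
  using card_image[OF crumpling_inj_flag_facet] crumpling_flag_facet by metis

lemma finite_flag_facet: "finite \<sigma> \<Longrightarrow> finite (flag_facet \<sigma> r)"
  by (simp add: flag_facet_def)

text \<open>
  A face uses a chain of faces of \<open>K\<close>. Ranking each vertex by the number of chain members that
  avoid it makes its lower set the smallest chain member that contains it. For a label \<open>w\<close> of the
  face, occurring in \<open>(\<tau>, w)\<close>, the condition on labels says exactly that this smallest member
  is \<open>\<tau>\<close>.
\<close>

lemma antiprism_face_le_flag:
  assumes F: "F \<in> antiprism K" and sub: "\<forall>p\<in>F. fst p \<subseteq> \<sigma>"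
  shows "\<exists>r::'a \<Rightarrow> nat. F \<subseteq> flag_facet \<sigma> r"
proof -
  obtain ps where ps: "F = set ps" "set ps \<subseteq> antiprism_vertices K"
    "sorted_wrt (\<lambda>p q. fst p \<subseteq> fst q) ps"
    and lab': "\<forall>p\<in>F. \<forall>q\<in>F. fst p \<subset> fst q \<longrightarrow> snd q \<notin> fst p"
    using F unfolding antiprism_def by blast
  have lab: "snd q \<notin> fst p" if "p \<in> F" "q \<in> F" "fst p \<subset> fst q" for p q
    using lab' that by blast
  have "\<forall>p\<in>set ps. \<forall>q\<in>set ps. fst p \<subseteq> fst q \<or> fst q \<subseteq> fst p"
    using ps(3) by (induction ps) auto
  then have chain: "fst p \<subseteq> fst q \<or> fst q \<subseteq> fst p" if "p \<in> F" "q \<in> F" for p q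
    using that ps(1) by blast
  have fin: "finite F" using ps(1) by simp
  \<comment> \<open>along a chain, these sets are nested, so they can be compared by cardinality\<close>
  define avoid where "avoid u = {T \<in> fst ` F. u \<notin> T}" for u
  define r where "r u = card (avoid u)" for u
  have avoid_fin: "finite (avoid u)" for u using fin by (simp add: avoid_def)
  have nested: "avoid u \<subseteq> avoid v \<or> avoid v \<subseteq> avoid u" for u v
    unfolding avoid_def using chain by (smt (verit, best) imageE mem_Collect_eq subset_iff)
  have r_le: "r u \<le> r v \<longleftrightarrow> avoid u \<subseteq> avoid v" for u v
    using nested avoid_fin unfolding r_def by (metis card_mono card_seteq)
  have "(\<tau>, w) \<in> flag_facet \<sigma> r" if p: "(\<tau>, w) \<in> F" for \<tau> w
  proof -
    have w: "w \<in> \<tau>" using p ps(1,2) by (auto simp: antiprism_vertices_def)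
    have "u \<in> \<tau>" if "r u \<le> r w" for u
      using that w p unfolding r_le avoid_def by force
    moreover have "r u \<le> r w" if u: "u \<in> \<tau>" for u
    proof -
      have "u \<in> T" if T: "T \<in> fst ` F" "w \<in> T" for T
      proof -
        obtain q where q: "q \<in> F" "T = fst q" using T(1) by blast
        have "\<not> T \<subset> \<tau>" using lab[OF q(1) p] q(2) T(2) by auto
        then show ?thesis using chain[OF q(1) p] q(2) u by auto
      qed
      then show ?thesis unfolding r_le avoid_def by blast
    qed
    ultimately have "\<tau> = {u\<in>\<sigma>. r u \<le> r w}" using sub p by force
    then show ?thesis using w unfolding flag_facet_def by blast
  qed
  then show ?thesis by (intro exI[of _ r]) auto
qed

lemma antiprism_face_top:
  assumes "F \<in> antiprism K" "abstract_complex K"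
  shows "\<exists>\<sigma>\<in>K. \<forall>p\<in>F. fst p \<subseteq> \<sigma>"
proof -
  obtain ps where ps: "F = set ps" "set ps \<subseteq> antiprism_vertices K"
    "sorted_wrt (\<lambda>p q. fst p \<subseteq> fst q) ps"
    using assms(1) unfolding antiprism_def by auto
  show ?thesis
  proof (cases ps rule: rev_cases)
    case Nil
    then show ?thesis using ps assms(2) by (auto simp: abstract_complex_def)
  next
    case (snoc qs q)
    then have "fst q \<in> K" using ps by (auto simp: antiprism_vertices_def)
    then show ?thesis using snoc ps by (intro bexI[of _ "fst q"]) (auto simp: sorted_wrt_append)
  qed
qed

lemma subset_flag_facet_antiprism:
  assumes "abstract_complex K" "\<sigma> \<in> K" "F \<subseteq> flag_facet \<sigma> r"
  shows "F \<in> antiprism K"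
proof -
  have fin: "finite F"
    using assms by (auto simp: abstract_complex_def intro: finite_subset[OF _ finite_flag_facet])
  then obtain xs where xs: "set xs = F" using finite_list by blast
  define ps where "ps = sort_key (\<lambda>p. r (snd p)) xs"
  have set: "set ps = F" using xs by (simp add: ps_def)
  have elem: "fst p = {u\<in>\<sigma>. r u \<le> r (snd p)}" "snd p \<in> \<sigma>" if "p \<in> F" for p
    using that assms(3) by (auto simp: flag_facet_def)
  have "sorted_wrt (\<lambda>p q. r (snd p) \<le> r (snd q)) ps"
    using sorted_sort_key[of "\<lambda>p. r (snd p)" xs] unfolding ps_def sorted_map .
  then have "sorted_wrt (\<lambda>p q. fst p \<subseteq> fst q) ps"
    by (rule sorted_wrt_mono_rel[rotated]) (auto simp: set elem(1))
  moreover have "set ps \<subseteq> antiprism_vertices K"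
  proof
    fix p assume "p \<in> set ps"
    then have p: "p \<in> F" by (simp add: set)
    have "fst p \<in> K" using assms(1,2) elem(1)[OF p] by (auto simp: abstract_complex_def)
    moreover have "snd p \<in> fst p" using elem(1,2)[OF p] by auto
    ultimately show "p \<in> antiprism_vertices K"
      by (auto simp: antiprism_vertices_def case_prod_unfold)
  qed
  moreover have "snd q \<notin> fst p" if "p \<in> F" "q \<in> F" "fst p \<subset> fst q" for p q
    using that elem(1)[OF that(1)] elem(1)[OF that(2)] by auto
  ultimately show ?thesis unfolding antiprism_def set[symmetric] by blast
qed

lemma antiprism_abstract_complex:
  assumes "abstract_complex K"
  shows "abstract_complex (antiprism K)"
proof -
  have "finite F" if "F \<in> antiprism K" for F using that by (auto simp: antiprism_def)
  moreover have "G \<in> antiprism K" if F: "F \<in> antiprism K" and G: "G \<subseteq> F" for F G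
  proof -
    obtain \<sigma> where \<sigma>: "\<sigma> \<in> K" "\<forall>p\<in>F. fst p \<subseteq> \<sigma>"
      using antiprism_face_top[OF F assms] by blast
    obtain r :: "'a \<Rightarrow> nat" where "F \<subseteq> flag_facet \<sigma> r"
      using antiprism_face_le_flag[OF F \<sigma>(2)] by blast
    with G show ?thesis using subset_flag_facet_antiprism[OF assms \<sigma>(1)] by blast
  qed
  moreover have "{} \<in> antiprism K"
    using subset_flag_facet_antiprism[OF assms, of "{}" "{}"] assms
    by (auto simp: abstract_complex_def)
  ultimately show ?thesis unfolding abstract_complex_def by blast
qed

lemma antiprism_locally_finite:
  assumes "abstract_complex K" "locally_finite_complex K"
  shows "locally_finite_complex (antiprism K)"
  unfolding locally_finite_complex_def
proof
  fix p :: "'a set \<times> 'a"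
  let ?S = "{\<sigma>\<in>K. snd p \<in> \<sigma>}"
  have "F \<in> (\<Union>\<sigma>\<in>?S. Pow (Pow \<sigma> \<times> \<sigma>))" if F: "F \<in> antiprism K" "p \<in> F" for F
  proof -
    obtain \<sigma> where \<sigma>: "\<sigma> \<in> K" "\<forall>p\<in>F. fst p \<subseteq> \<sigma>"
      using antiprism_face_top[OF F(1) assms(1)] by blast
    obtain r :: "'a \<Rightarrow> nat" where "F \<subseteq> flag_facet \<sigma> r"
      using antiprism_face_le_flag[OF F(1) \<sigma>(2)] by blast
    also have "\<dots> \<subseteq> Pow \<sigma> \<times> \<sigma>" by (auto simp: flag_facet_def)
    finally show ?thesis using \<sigma>(1) F(2) by force
  qed
  then have "{F \<in> antiprism K. p \<in> F} \<subseteq> (\<Union>\<sigma>\<in>?S. Pow (Pow \<sigma> \<times> \<sigma>))" by blast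
  moreover have "finite (\<Union>\<sigma>\<in>?S. Pow (Pow \<sigma> \<times> \<sigma>))"
    using assms by (auto simp: locally_finite_complex_def abstract_complex_def)
  ultimately show "finite {F \<in> antiprism K. p \<in> F}"
    by (rule finite_subset)
qed

lemma flag_facet_facets:
  assumes "abstract_complex K" "\<sigma> \<in> facets d K"
  shows "flag_facet \<sigma> r \<in> facets d (antiprism K)"
  using subset_flag_facet_antiprism[OF assms(1), of \<sigma> _ r] assms(2)
  by (simp add: facets_def card_flag_facet)

lemma antiprism_face_le_facet:
  assumes "abstract_complex K" "pure_complex d K" "F \<in> antiprism K"
  shows "\<exists>\<sigma>\<in>facets d K. \<exists>r::'a \<Rightarrow> nat. F \<subseteq> flag_facet \<sigma> r"
proof -
  obtain \<tau> where \<tau>: "\<tau> \<in> K" "\<forall>p\<in>F. fst p \<subseteq> \<tau>"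
    using antiprism_face_top[OF assms(3,1)] by blast
  then obtain \<sigma> where "\<sigma> \<in> facets d K" "\<tau> \<subseteq> \<sigma>"
    using assms(2) by (auto simp: pure_complex_def)
  moreover from this have "\<exists>r::'a \<Rightarrow> nat. F \<subseteq> flag_facet \<sigma> r"
    using \<tau>(2) by (intro antiprism_face_le_flag[OF assms(3)]) blast
  ultimately show ?thesis by blast
qed

lemma antiprism_pure:
  assumes "abstract_complex K" "pure_complex d K"
  shows "pure_complex d (antiprism K)"
proof -
  have "card F \<le> d + 1 \<and> (\<exists>G\<in>facets d (antiprism K). F \<subseteq> G)"
    if F: "F \<in> antiprism K" for F
  proof -
    obtain \<sigma> and r :: "'a \<Rightarrow> nat" where \<sigma>: "\<sigma> \<in> facets d K" "F \<subseteq> flag_facet \<sigma> r"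
      using antiprism_face_le_facet[OF assms F] by blast
    then have "card F \<le> card (flag_facet \<sigma> r)"
      by (intro card_mono finite_flag_facet facets_finite)
    moreover have "card (flag_facet \<sigma> r) = d + 1"
      using \<sigma>(1) by (simp add: card_flag_facet facets_def)
    ultimately show ?thesis using \<sigma> flag_facet_facets[OF assms(1)] by metis
  qed
  then show ?thesis unfolding pure_complex_def by blast
qed

text \<open>
  A facet lies in a flag facet, and the two have the same number of vertices.
\<close>

lemma antiprism_facetE:
  assumes "abstract_complex K" "pure_complex d K" "F \<in> facets d (antiprism K)"
  obtains r :: "'a \<Rightarrow> nat" where "crumpling ` F \<in> facets d K" "F = flag_facet (crumpling ` F) r"
proof -
  have F: "F \<in> antiprism K" "card F = d + 1" using assms(3) by (auto simp: facets_def)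
  obtain \<sigma> and r :: "'a \<Rightarrow> nat" where \<sigma>: "\<sigma> \<in> facets d K" "F \<subseteq> flag_facet \<sigma> r"
    using antiprism_face_le_facet[OF assms(1,2) F(1)] by blast
  have "card (flag_facet \<sigma> r) = card F"
    using \<sigma>(1) F(2) by (simp add: card_flag_facet facets_def)
  then have "F = flag_facet \<sigma> r"
    using \<sigma> by (intro card_seteq finite_flag_facet facets_finite) auto
  then show thesis using that[of r] \<sigma>(1) crumpling_flag_facet[of \<sigma> r] by simp
qed

lemma crumpling_facet:
  assumes "abstract_complex K" "pure_complex d K" "F \<in> facets d (antiprism K)"
  shows "crumpling ` F \<in> facets d K" "inj_on crumpling F"
proof -
  obtain r :: "'a \<Rightarrow> nat" where r: "crumpling ` F \<in> facets d K" "F = flag_facet (crumpling ` F) r"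
    using assms by (rule antiprism_facetE)
  show "crumpling ` F \<in> facets d K" by (rule r(1))
  show "inj_on crumpling F"
    by (subst r(2)) (rule crumpling_inj_flag_facet)
qed

section \<open>Pushing projectivities forward\<close>

text \<open>
  Induction along the path upstairs. A step between neighbors \<open>R \<union> {x}\<close> and \<open>R \<union> {y}\<close> disappears
  downstairs if \<open>x\<close> and \<open>y\<close> have the same label and otherwise becomes a step of \<open>K\<close>.
\<close>

lemma crumpling_projects:
  assumes K: "abstract_complex K" "pure_complex d K"
    and "projects d (antiprism K) F G g"
  shows "\<exists>h. projects d K (crumpling ` F) (crumpling ` G) h \<and>
             (\<forall>p\<in>F. h (crumpling p) = crumpling (g p))"
  using assms(3)
proof (induction rule: projects.induct)
  case (single F)
  have "projects d K (crumpling ` F) (crumpling ` F) (\<lambda>v\<in>crumpling ` F. v)"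
    by (intro projects.single crumpling_facet[OF K single])
  moreover have "\<forall>p\<in>F. (\<lambda>v\<in>crumpling ` F. v) (crumpling p) = crumpling ((\<lambda>p\<in>F. p) p)"
    by simp
  ultimately show ?case by blast
next
  case (step F G H g)
  let ?f = "crumpling :: 'a set \<times> 'a \<Rightarrow> 'a"
  note A = antiprism_abstract_complex[OF K(1)]
  obtain h where h: "projects d K (?f ` G) (?f ` H) h" "\<forall>p\<in>G. h (?f p) = ?f (g p)"
    using step by blast
  obtain R x y where R: "R \<in> antiprism K" "finite R" "card R = d"
      "x \<notin> R" "y \<notin> R" "x \<noteq> y" "F = insert x R" "G = insert y R"
    using step(1) A by (rule neighborsE)
  have facF: "F \<in> facets d (antiprism K)" and facG: "G \<in> facets d (antiprism K)"
    using step(1) by (auto simp: neighbors_def)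
  note im = crumpling_facet(1)[OF K facF] crumpling_facet(1)[OF K facG]
  note inj = crumpling_facet(2)[OF K facF] crumpling_facet(2)[OF K facG]
  have imF: "?f ` F = insert (?f x) (?f ` R)" and imG: "?f ` G = insert (?f y) (?f ` R)"
    by (simp_all add: R(7,8))
  have nin: "?f x \<notin> ?f ` R" "?f y \<notin> ?f ` R" and injR: "inj_on ?f R"
    using inj R(4,5) by (simp_all add: R(7,8))
  have persp: "perspectivity F G p = (if p = x then y else p)" if "p \<in> F" for p
    using that unfolding R(7,8) perspectivity_insert[OF R(4-6)] by simp
  have perspG: "perspectivity F G p \<in> G" if "p \<in> F" for p
    using that persp[OF that] by (auto simp: R(7,8))
  show ?case
  proof (cases "?f x = ?f y")
    case True
    then have "?f ` F = ?f ` G" by (simp add: imF imG)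
    moreover have "h (?f p) = ?f (compose F g (perspectivity F G) p)" if p: "p \<in> F" for p
    proof -
      have "?f (perspectivity F G p) = ?f p" using persp[OF p] True by simp
      moreover have "h (?f (perspectivity F G p)) = ?f (g (perspectivity F G p))"
        using h(2) perspG[OF p] by blast
      ultimately show ?thesis using p by (simp add: compose_def)
    qed
    ultimately show ?thesis using h(1) by (intro exI[of _ h]) simp
  next
    case False
    have "?f ` R \<in> ridges d K"
    proof -
      have "card (?f ` R) = d" using card_image[OF injR] R(3) by simp
      moreover have "?f ` R \<in> K"
        using im(1) imF K(1) by (auto simp: facets_def abstract_complex_def)
      ultimately show ?thesis by (simp add: ridges_def)
    qed
    moreover have "?f ` R \<subseteq> ?f ` F" "?f ` R \<subseteq> ?f ` G"
      by (auto simp only: imF imG)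
    moreover have "?f x \<in> ?f ` F" "?f x \<notin> ?f ` G"
      unfolding imF imG using False nin by simp_all
    ultimately have nb: "neighbors d K (?f ` F) (?f ` G)"
      using im unfolding neighbors_def by metis
    have "perspectivity (?f ` F) (?f ` G) (?f p) = ?f (perspectivity F G p)" if p: "p \<in> F" for p
    proof -
      have "?f p = ?f x \<longleftrightarrow> p = x" 
        by (rule inj_on_eq_iff[OF inj(1) p]) (simp add: R(7))
      moreover have "?f p \<in> insert (?f x) (?f ` R)" using p R(7) by auto
      ultimately show ?thesis
        unfolding imF imG perspectivity_insert[OF nin False] persp[OF p] by simp
    qed
    then have "compose (?f ` F) h (perspectivity (?f ` F) (?f ` G)) (?f p)
        = ?f (compose F g (perspectivity F G) p)" if "p \<in> F" for p
      using that h(2) perspG by (simp add: compose_def)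
    then show ?thesis
      by (intro exI[of _ "compose (?f ` F) h (perspectivity (?f ` F) (?f ` G))"] conjI ballI
          projects.step[OF nb h(1)]) simp
  qed
qed

section \<open>Lifting projectivities\<close>

text \<open>
  A path whose projectivity preserves labels replaces the condition that all facets of the path
  lie over the same facet of \<open>K\<close>: this is all that lifting needs, and it composes.
\<close>

definition fibre_linked :: "nat \<Rightarrow> 'a set set \<Rightarrow> ('a set \<times> 'a) set \<Rightarrow> ('a set \<times> 'a) set \<Rightarrow> bool" where
  "fibre_linked d K F G \<longleftrightarrow>
     (\<exists>g. projects d (antiprism K) F G g \<and> (\<forall>p\<in>F. crumpling (g p) = crumpling p))"

lemma fibre_linked_refl: "F \<in> facets d (antiprism K) \<Longrightarrow> fibre_linked d K F F"
  unfolding fibre_linked_def using projects.single by (intro exI[of _ "\<lambda>v\<in>F. v"]) fastforce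

lemma fibre_linked_trans:
  assumes "abstract_complex K" "fibre_linked d K F G" "fibre_linked d K G H"
  shows "fibre_linked d K F H"
proof -
  note A = antiprism_abstract_complex[OF assms(1)]
  obtain g where g: "projects d (antiprism K) F G g" "\<forall>p\<in>F. crumpling (g p) = crumpling p"
    using assms(2) by (auto simp: fibre_linked_def)
  obtain h where h: "projects d (antiprism K) G H h" "\<forall>p\<in>G. crumpling (h p) = crumpling p"
    using assms(3) by (auto simp: fibre_linked_def)
  show ?thesis unfolding fibre_linked_def
    using projects_trans[OF g(1) h(1) A] g(2) h(2) bij_betwE[OF projects_bij[OF g(1) A]]
    by (intro exI[of _ "compose F h g"]) (auto simp: compose_def)
qed

lemma fibre_linked_sym:
  assumes "abstract_complex K" "fibre_linked d K F G"
  shows "fibre_linked d K G F"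
proof -
  note A = antiprism_abstract_complex[OF assms(1)]
  obtain g where g: "projects d (antiprism K) F G g" "\<forall>p\<in>F. crumpling (g p) = crumpling p"
    using assms(2) by (auto simp: fibre_linked_def)
  obtain h where h: "projects d (antiprism K) G F h" "\<forall>p\<in>F. h (g p) = p"
    using projects_inverse[OF g(1) A] by blast
  have "crumpling (h q) = crumpling q" if "q \<in> G" for q
    using that g(2) h(2) projects_bij[OF g(1) A] unfolding bij_betw_def by force
  with h(1) show ?thesis unfolding fibre_linked_def by blast
qed

text \<open>
  If only the vertex labelled \<open>v\<close> changes, the two facets share the ridge of all other vertices
  (or coincide), and the perspectivity exchanges two vertices with the same label \<open>v\<close>.
\<close>

lemma fibre_linked_single_change:
  fixes r :: "'a \<Rightarrow> 'b::linorder" and s :: "'a \<Rightarrow> 'c::linorder"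
  assumes K: "abstract_complex K" and \<sigma>: "\<sigma> \<in> facets d K" and v: "v \<in> \<sigma>"
    and same: "\<And>w. w \<in> \<sigma> \<Longrightarrow> w \<noteq> v \<Longrightarrow> {u\<in>\<sigma>. r u \<le> r w} = {u\<in>\<sigma>. s u \<le> s w}"
  shows "fibre_linked d K (flag_facet \<sigma> r) (flag_facet \<sigma> s)"
proof -
  note A = antiprism_abstract_complex[OF K]
  define R where "R = (\<lambda>w. ({u\<in>\<sigma>. r u \<le> r w}, w)) ` (\<sigma> - {v})"
  define x where "x = ({u\<in>\<sigma>. r u \<le> r v}, v)"
  define y where "y = ({u\<in>\<sigma>. s u \<le> s v}, v)"
  have R': "R = (\<lambda>w. ({u\<in>\<sigma>. s u \<le> s w}, w)) ` (\<sigma> - {v})"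
    unfolding R_def using same by (intro image_cong) auto
  have F: "flag_facet \<sigma> r = insert x R"
    unfolding flag_facet_def R_def x_def using v by auto
  have G: "flag_facet \<sigma> s = insert y R"
    unfolding flag_facet_def R' y_def using v by auto
  have nin: "x \<notin> R" "y \<notin> R" by (auto simp: R_def x_def y_def)
  have facF: "flag_facet \<sigma> r \<in> facets d (antiprism K)"
    and facG: "flag_facet \<sigma> s \<in> facets d (antiprism K)"
    using flag_facet_facets[OF K \<sigma>] by auto
  show ?thesis
  proof (cases "x = y")
    case True
    then show ?thesis using F G facF fibre_linked_refl by metis
  next
    case False
    have "card R = card (\<sigma> - {v})" unfolding R_def by (intro card_image) (auto simp: inj_on_def)
    then have "card R = d" using \<sigma> v by (simp add: facets_def)
    moreover have "R \<in> antiprism K"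
      using A facF F by (auto simp: abstract_complex_def facets_def)
    ultimately have "R \<in> ridges d (antiprism K)" by (simp add: ridges_def)
    then have nb: "neighbors d (antiprism K) (flag_facet \<sigma> r) (flag_facet \<sigma> s)"
      unfolding neighbors_def using facF facG F G nin False by blast
    have "crumpling (perspectivity (flag_facet \<sigma> r) (flag_facet \<sigma> s) p) = crumpling p"
      if "p \<in> flag_facet \<sigma> r" for p
      using that unfolding F G perspectivity_insert[OF nin False]
      by (auto simp: crumpling_def x_def y_def)
    with projects_neighbors[OF nb A] show ?thesis unfolding fibre_linked_def by blast
  qed
qed

lemma flag_facet_cong:
  assumes "\<And>u v. u \<in> \<sigma> \<Longrightarrow> v \<in> \<sigma> \<Longrightarrow> r u \<le> r v \<longleftrightarrow> s u \<le> s v"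
  shows "flag_facet \<sigma> r = flag_facet \<sigma> s"
  unfolding flag_facet_def using assms by (intro image_cong) auto

text \<open>
  The ordered partition of \<open>r\<close> is refined by the linear order \<open>e\<close> inside each block, one vertex at a
  time: with ranks \<open>(r v, min (e v) c)\<close>, the vertices with \<open>e\<close>-value below \<open>c\<close> are already split off
  the front of their blocks. Raising \<open>c\<close> by one splits off just the vertex with \<open>e v = c\<close>, if any,
  and by injectivity of \<open>e\<close> there is only one.
\<close>

lemma fibre_linked_refine:
  fixes r :: "'a \<Rightarrow> 'b::linorder" and e :: "'a \<Rightarrow> nat"
  assumes K: "abstract_complex K" and \<sigma>: "\<sigma> \<in> facets d K" and e: "inj_on e \<sigma>"
  shows "fibre_linked d K (flag_facet \<sigma> r) (flag_facet \<sigma> (\<lambda>v. (r v, e v)))"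
proof -
  define F where "F c = flag_facet \<sigma> (\<lambda>v. (r v, min (e v) c))" for c
  have facF: "F c \<in> facets d (antiprism K)" for c
    unfolding F_def by (rule flag_facet_facets[OF K \<sigma>])
  have step: "min a c \<le> min b c \<longleftrightarrow> min a (Suc c) \<le> min b (Suc c)" if "b \<noteq> c" for a b c :: nat
    using that by (auto simp: min_def)
  have link: "fibre_linked d K (F c) (F (Suc c))" for c
  proof (cases "\<exists>v\<in>\<sigma>. e v = c")
    case True
    then obtain v where v: "v \<in> \<sigma>" "e v = c" by blast
    have ne: "e w \<noteq> c" if "w \<in> \<sigma>" "w \<noteq> v" for w
      using that e v by (auto simp: inj_on_def)
    show ?thesis unfolding F_def
    proof (rule fibre_linked_single_change[OF K \<sigma> v(1)])
      fix w assume "w \<in> \<sigma>" "w \<noteq> v"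
      from step[OF ne[OF this]]
      show "{u\<in>\<sigma>. (r u, min (e u) c) \<le> (r w, min (e w) c)}
          = {u\<in>\<sigma>. (r u, min (e u) (Suc c)) \<le> (r w, min (e w) (Suc c))}"
        by (simp only: less_eq_prod_simp)
    qed
  next
    case False
    then have ne: "e w \<noteq> c" if "w \<in> \<sigma>" for w using that by blast
    have "F c = F (Suc c)"
      unfolding F_def by (intro flag_facet_cong) (simp only: less_eq_prod_simp step[OF ne])
    then show ?thesis using facF fibre_linked_refl by metis
  qed
  have "fibre_linked d K (F 0) (F c)" for c
  proof (induction c)
    case 0
    show ?case by (rule fibre_linked_refl[OF facF])
  next
    case (Suc c)
    then show ?case using link fibre_linked_trans[OF K] by blast
  qed
  moreover have "F 0 = flag_facet \<sigma> r"
    unfolding F_def by (rule flag_facet_cong) auto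
  moreover have "F (Max (e ` \<sigma>)) = flag_facet \<sigma> (\<lambda>v. (r v, e v))"
    unfolding F_def using facets_finite[OF \<sigma>] by (intro flag_facet_cong) auto
  ultimately show ?thesis by metis
qed

lemma card_lower_set_less:
  fixes r :: "'a \<Rightarrow> 'b::linorder"
  assumes "finite \<sigma>" "v \<in> \<sigma>" "r u < r v"
  shows "card {w\<in>\<sigma>. r w \<le> r u} < card {w\<in>\<sigma>. r w \<le> r v}"
proof (rule psubset_card_mono)
  have "v \<in> {w\<in>\<sigma>. r w \<le> r v} - {w\<in>\<sigma>. r w \<le> r u}" using assms by auto
  then show "{w\<in>\<sigma>. r w \<le> r u} \<subset> {w\<in>\<sigma>. r w \<le> r v}" using assms(3) by force
qed (use assms in simp)

lemma flag_facet_card_rank: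
  fixes r :: "'a \<Rightarrow> 'b::linorder"
  assumes "finite \<sigma>"
  shows "flag_facet \<sigma> (\<lambda>v. card {u\<in>\<sigma>. r u \<le> r v}) = flag_facet \<sigma> r"
proof (rule flag_facet_cong)
  fix u v assume u: "u \<in> \<sigma>" and v: "v \<in> \<sigma>"
  have "card {w\<in>\<sigma>. r w \<le> r v} < card {w\<in>\<sigma>. r w \<le> r u}" if "r v < r u"
    by (rule card_lower_set_less[of \<sigma> u r v, OF assms u that])
  moreover have "card {w\<in>\<sigma>. r w \<le> r u} \<le> card {w\<in>\<sigma>. r w \<le> r v}" if "r u \<le> r v"
    using assms that by (intro card_mono) auto
  ultimately show "card {w\<in>\<sigma>. r w \<le> r u} \<le> card {w\<in>\<sigma>. r w \<le> r v} \<longleftrightarrow> r u \<le> r v"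
    by (meson not_le)
qed

text \<open>
  The partition refined to a linear order \<open>l\<close> is a common refinement of \<open>r\<close> and of the one-block
  partition. The refinement lemma needs ranks in \<open>nat\<close>, so for the second use \<open>l\<close> is replaced by
  the position \<open>s v\<close> of \<open>v\<close> in this order.
\<close>

lemma fibre_linked_trivial:
  fixes r :: "'a \<Rightarrow> 'b::linorder"
  assumes K: "abstract_complex K" and \<sigma>: "\<sigma> \<in> facets d K"
  shows "fibre_linked d K (flag_facet \<sigma> r) (flag_facet \<sigma> (\<lambda>_. 0::nat))"
proof -
  have fin: "finite \<sigma>" by (rule facets_finite[OF \<sigma>])
  obtain e :: "'a \<Rightarrow> nat" where e: "inj_on e \<sigma>"
    using fin finite_imp_inj_to_nat_seg by blast
  define l where "l v = (r v, e v)" for v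
  define s where "s v = card {u\<in>\<sigma>. l u \<le> l v}" for v
  have l: "inj_on l \<sigma>" using e by (auto simp: l_def inj_on_def)
  have "s u < s v" if "u \<in> \<sigma>" "v \<in> \<sigma>" "l u < l v" for u v
    unfolding s_def by (rule card_lower_set_less[OF fin that(2,3)])
  then have s: "inj_on s \<sigma>"
    using l unfolding inj_on_def by (metis less_irrefl linorder_neqE)
  have "flag_facet \<sigma> (\<lambda>v. (0::nat, s v)) = flag_facet \<sigma> s"
    by (rule flag_facet_cong) auto
  also have "\<dots> = flag_facet \<sigma> l"
    unfolding s_def by (rule flag_facet_card_rank[OF fin])
  finally have "fibre_linked d K (flag_facet \<sigma> (\<lambda>_. 0::nat)) (flag_facet \<sigma> l)"
    using fibre_linked_refine[OF K \<sigma> s, of "\<lambda>_. 0::nat"] by simp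
  moreover have "fibre_linked d K (flag_facet \<sigma> r) (flag_facet \<sigma> l)"
    unfolding l_def by (rule fibre_linked_refine[OF K \<sigma> e])
  ultimately show ?thesis using fibre_linked_sym[OF K] fibre_linked_trans[OF K] by blast
qed

lemma fibre_linked_same_image:
  assumes K: "abstract_complex K" "pure_complex d K"
    and F: "F \<in> facets d (antiprism K)" and G: "G \<in> facets d (antiprism K)"
    and eq: "crumpling ` F = crumpling ` G"
  shows "fibre_linked d K F G"
proof -
  obtain r :: "'a \<Rightarrow> nat" where r: "crumpling ` F \<in> facets d K" "F = flag_facet (crumpling ` F) r"
    using antiprism_facetE[OF K F] by blast
  obtain s :: "'a \<Rightarrow> nat" where s: "G = flag_facet (crumpling ` G) s"
    using antiprism_facetE[OF K G] by blast
  let ?T = "flag_facet (crumpling ` F) (\<lambda>_. 0::nat)"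
  have "fibre_linked d K F ?T" "fibre_linked d K G ?T"
    using fibre_linked_trivial[OF K(1) r(1), of r] fibre_linked_trivial[OF K(1) r(1), of s]
      r(2) s eq by simp_all
  then show ?thesis using fibre_linked_sym[OF K(1)] fibre_linked_trans[OF K(1)] by blast
qed

text \<open>
  The two facets put the common ridge \<open>\<rho>\<close> in the first block, so that they share the vertices
  \<open>(\<rho>, u)\<close> with \<open>u \<in> \<rho>\<close>.
\<close>

lemma lift_neighbors:
  assumes K: "abstract_complex K" and nb: "neighbors d K \<sigma> \<tau>"
  shows "\<exists>F G. neighbors d (antiprism K) F G \<and> crumpling ` F = \<sigma> \<and> crumpling ` G = \<tau> \<and>
     (\<forall>p\<in>F. crumpling (perspectivity F G p) = perspectivity \<sigma> \<tau> (crumpling p))"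
proof -
  note A = antiprism_abstract_complex[OF K]
  obtain \<rho> x y where h: "\<rho> \<in> K" "finite \<rho>" "card \<rho> = d" "x \<notin> \<rho>" "y \<notin> \<rho>" "x \<noteq> y"
    "\<sigma> = insert x \<rho>" "\<tau> = insert y \<rho>"
    using nb K by (rule neighborsE)
  have fac: "\<sigma> \<in> facets d K" "\<tau> \<in> facets d K" using nb by (auto simp: neighbors_def)
  define F where "F = flag_facet \<sigma> (\<lambda>u. if u = x then 1 else 0::nat)"
  define G where "G = flag_facet \<tau> (\<lambda>u. if u = y then 1 else 0::nat)"
  define R where "R = (\<lambda>u. (\<rho>, u)) ` \<rho>"
  have sub: "{u \<in> insert x \<rho>. u \<noteq> x} = \<rho>" "{u \<in> insert y \<rho>. u \<noteq> y} = \<rho>" using h by auto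
  have F: "F = insert (\<sigma>, x) R"
    unfolding F_def flag_facet_def R_def h(7) using h(4) sub(1)
    by (auto simp: image_iff)
  have G: "G = insert (\<tau>, y) R"
    unfolding G_def flag_facet_def R_def h(8) using h(5) sub(2)
    by (auto simp: image_iff)
  have facF: "F \<in> facets d (antiprism K)" and facG: "G \<in> facets d (antiprism K)"
    unfolding F_def G_def using flag_facet_facets[OF K] fac by auto
  have im: "crumpling ` F = \<sigma>" "crumpling ` G = \<tau>"
    unfolding F_def G_def by (simp_all only: crumpling_flag_facet)
  have "card R = d" unfolding R_def using h(3) by (subst card_image) (auto simp: inj_on_def)
  moreover have "R \<in> antiprism K"
    using A facF F by (auto simp: abstract_complex_def facets_def)
  ultimately have "R \<in> ridges d (antiprism K)" by (simp add: ridges_def)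
  moreover have "F \<noteq> G" using im nb by (auto simp: neighbors_def)
  ultimately have "neighbors d (antiprism K) F G"
    unfolding neighbors_def using facF facG F G by blast
  moreover have "crumpling (perspectivity F G p) = perspectivity \<sigma> \<tau> (crumpling p)"
    if "p \<in> F" for p
  proof -
    have "(\<sigma>, x) \<notin> R" "(\<tau>, y) \<notin> R" "(\<sigma>, x) \<noteq> (\<tau>, y)" using h by (auto simp: R_def)
    from perspectivity_insert[OF this] perspectivity_insert[OF h(4-6)] that h(4)
    show ?thesis by (auto simp: F G h(7,8) crumpling_def R_def)
  qed
  ultimately show ?thesis using im by blast
qed

text \<open>
  The lifts of the steps of a path need not fit together: the end of one and the start of the next
  lie over the same facet of \<open>K\<close> but may differ. Label-preserving connections fill these gaps, and
  they also allow both end facets to be prescribed.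
\<close>

lemma lift_projects:
  assumes K: "abstract_complex K" "pure_complex d K" and "projects d K \<sigma> \<tau> h"
    and "F \<in> facets d (antiprism K)" "crumpling ` F = \<sigma>"
    and "G \<in> facets d (antiprism K)" "crumpling ` G = \<tau>"
  shows "\<exists>g. projects d (antiprism K) F G g \<and> (\<forall>p\<in>F. crumpling (g p) = h (crumpling p))"
  using assms(3-)
proof (induction arbitrary: F rule: projects.induct)
  case (single \<sigma>)
  then have "fibre_linked d K F G" by (intro fibre_linked_same_image[OF K]) auto
  then show ?case using single unfolding fibre_linked_def by auto
next
  case (step \<sigma> \<tau> \<rho> h)
  note A = antiprism_abstract_complex[OF K(1)]
  obtain F1 F2 where nb: "neighbors d (antiprism K) F1 F2"
    and im: "crumpling ` F1 = \<sigma>" "crumpling ` F2 = \<tau>"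
    and pe: "\<forall>p\<in>F1. crumpling (perspectivity F1 F2 p) = perspectivity \<sigma> \<tau> (crumpling p)"
    using lift_neighbors[OF K(1) step(1)] by blast
  have fac: "F1 \<in> facets d (antiprism K)" "F2 \<in> facets d (antiprism K)"
    using nb by (auto simp: neighbors_def)
  have "fibre_linked d K F F1"
    using step.prems im fac by (intro fibre_linked_same_image[OF K]) auto
  then obtain a where a: "projects d (antiprism K) F F1 a" "\<forall>p\<in>F. crumpling (a p) = crumpling p"
    unfolding fibre_linked_def by blast
  obtain b where b: "projects d (antiprism K) F2 G b" "\<forall>p\<in>F2. crumpling (b p) = h (crumpling p)"
    using step.IH[of F2] step.prems fac im by blast
  let ?c = "compose F1 b (perspectivity F1 F2)"
  have "projects d (antiprism K) F G (compose F ?c a)"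
    by (rule projects_trans[OF a(1) projects.step[OF nb b(1)] A])
  moreover have "crumpling (compose F ?c a p) =
      compose \<sigma> h (perspectivity \<sigma> \<tau>) (crumpling p)" if p: "p \<in> F" for p
  proof -
    have a1: "a p \<in> F1" using bij_betwE[OF projects_bij[OF a(1) A]] p by blast
    moreover have "perspectivity F1 F2 (a p) \<in> F2"
      using bij_betwE[OF perspectivity_bij[OF nb A]] a1 by blast
    moreover have "crumpling p \<in> \<sigma>" using step.prems p by blast
    ultimately show ?thesis using p a(2) b(2) pe by (auto simp: compose_def)
  qed
  ultimately show ?case by blast
qed

lemma antiprism_strongly_connected:
  assumes K: "abstract_complex K" "pure_complex d K" and "strongly_connected d K"
  shows "strongly_connected d (antiprism K)"
  unfolding strongly_connected_iff
proof (intro ballI)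
  fix F G assume FG: "F \<in> facets d (antiprism K)" "G \<in> facets d (antiprism K)"
  have "crumpling ` F \<in> facets d K" "crumpling ` G \<in> facets d K"
    using crumpling_facet(1)[OF K] FG by auto
  then obtain h where "projects d K (crumpling ` F) (crumpling ` G) h"
    using assms(3) by (auto simp: strongly_connected_iff)
  from lift_projects[OF K this FG(1) _ FG(2)] show "\<exists>g. projects d (antiprism K) F G g" by blast
qed

section \<open>The isomorphism\<close>

lemma induced_map_eqI:
  assumes "inj_on f S" "h \<in> extensional (f ` S)" "\<And>x. x \<in> S \<Longrightarrow> h (f x) = f (g x)"
  shows "induced_map f S g = h"
proof (rule extensionalityI)
  show "induced_map f S g \<in> extensional (f ` S)" by (simp add: induced_map_def)
  show "h \<in> extensional (f ` S)" by fact
  fix v assume "v \<in> f ` S"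
  then show "induced_map f S g v = h v" using assms by (auto simp: induced_map_def)
qed

lemma induced_map_apply:
  "inj_on f S \<Longrightarrow> x \<in> S \<Longrightarrow> induced_map f S g (f x) = f (g x)"
  by (simp add: induced_map_def)

lemma crumpling_perm_group_iso:
  fixes K :: "'a set set"
  assumes K: "abstract_complex K" "pure_complex d K" and F: "F \<in> facets d (antiprism K)"
  shows "perm_group_iso F (projectivities d (antiprism K) F)
          (crumpling ` F) (projectivities d K (crumpling ` F))
          crumpling (induced_map crumpling F)"
proof -
  let ?f = "crumpling :: 'a set \<times> 'a \<Rightarrow> 'a"
  let ?P = "projectivities d (antiprism K) F" and ?Q = "projectivities d K (?f ` F)"
  let ?\<phi> = "induced_map ?f F"
  note A = antiprism_abstract_complex[OF K(1)]
  note im = crumpling_facet(1)[OF K F] and inj = crumpling_facet(2)[OF K F]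
  note subP = projectivities_subset_Bij[OF A, of d F]
  note subQ = projectivities_subset_Bij[OF K(1), of d "?f ` F"]
  have PF: "g p \<in> F" if "g \<in> ?P" "p \<in> F" for g p
    using that subP by (auto simp: Bij_def bij_betw_def)
  have ap: "?\<phi> g (?f p) = ?f (g p)" if "p \<in> F" for g p
    by (rule induced_map_apply[OF inj that])
  have into: "?\<phi> g \<in> ?Q" if g: "g \<in> ?P" for g
  proof -
    obtain h where h: "projects d K (?f ` F) (?f ` F) h" "\<forall>p\<in>F. h (?f p) = ?f (g p)"
      using crumpling_projects[OF K, of F F g] g by (auto simp: projectivities_eq)
    then have "?\<phi> g = h" by (intro induced_map_eqI[OF inj projects_extensional]) auto
    then show ?thesis using h(1) by (simp add: projectivities_eq)
  qed
  have "?Q \<subseteq> ?\<phi> ` ?P"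
  proof
    fix h assume "h \<in> ?Q"
    then have h: "projects d K (?f ` F) (?f ` F) h" by (simp add: projectivities_eq)
    from lift_projects[OF K h F refl F refl]
    obtain g where g: "projects d (antiprism K) F F g" "\<forall>p\<in>F. ?f (g p) = h (?f p)" by blast
    have "?\<phi> g = h"
      using projects_extensional[OF h] g(2) by (intro induced_map_eqI[OF inj]) auto
    then show "h \<in> ?\<phi> ` ?P" using g(1) by (auto simp: projectivities_eq)
  qed
  moreover have "inj_on ?\<phi> ?P"
  proof (rule inj_onI)
    fix g h assume gh: "g \<in> ?P" "h \<in> ?P" "?\<phi> g = ?\<phi> h"
    have "g p = h p" if "p \<in> F" for p
      using ap[OF that, of g] ap[OF that, of h] gh PF that inj by (metis inj_onD)
    moreover have "g \<in> extensional F" "h \<in> extensional F"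
      using subP gh by (auto simp: Bij_def)
    ultimately show "g = h" by (intro extensionalityI) auto
  qed
  ultimately have bij: "bij_betw ?\<phi> ?P ?Q" using into by (auto simp: bij_betw_def)
  have "?\<phi> (g \<otimes>\<^bsub>Sym F\<^esub> h) = ?\<phi> g \<otimes>\<^bsub>Sym (?f ` F)\<^esub> ?\<phi> h" if g: "g \<in> ?P" and h: "h \<in> ?P" for g h
  proof -
    have "?\<phi> (compose F h g) = compose (?f ` F) (?\<phi> h) (?\<phi> g)"
    proof (rule induced_map_eqI[OF inj])
      fix p assume "p \<in> F"
      then show "compose (?f ` F) (?\<phi> h) (?\<phi> g) (?f p) = ?f (compose F h g p)"
        using ap PF[OF g] by (simp add: compose_def)
    qed simp
    moreover have "g \<otimes>\<^bsub>Sym F\<^esub> h = compose F h g"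
      using g h subP by (intro mult_Sym) blast+
    moreover have "?\<phi> g \<otimes>\<^bsub>Sym (?f ` F)\<^esub> ?\<phi> h = compose (?f ` F) (?\<phi> h) (?\<phi> g)"
      using into[OF g] into[OF h] subQ by (intro mult_Sym) blast+
    ultimately show ?thesis by simp
  qed
  with bij into have "?\<phi> \<in> iso ((Sym F)\<lparr>carrier := ?P\<rparr>) ((Sym (?f ` F))\<lparr>carrier := ?Q\<rparr>)"
    by (auto simp: iso_def hom_def)
  then show ?thesis
    unfolding perm_group_iso_def
    using projectivities_subgroup[OF A F] projectivities_subgroup[OF K(1) im] inj ap
    by (auto simp: bij_betw_def)
qed

theorem propositionA1p3:
  fixes K :: "'a set set" and d :: nat
  assumes "abstract_complex K"
    and "locally_finite_complex K"
    and "pure_complex d K"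
    and "strongly_connected d K"
  shows "abstract_complex (antiprism K) \<and> locally_finite_complex (antiprism K) \<and>
     pure_complex d (antiprism K) \<and> strongly_connected d (antiprism K) \<and>
     (\<forall>\<sigma>'\<in>facets d (antiprism K).
        crumpling ` \<sigma>' \<in> facets d K \<and>
        perm_group_iso
          \<sigma>' (projectivities d (antiprism K) \<sigma>')
          (crumpling ` \<sigma>') (projectivities d K (crumpling ` \<sigma>'))
          crumpling (induced_map crumpling \<sigma>'))"
proof (intro conjI ballI)
  fix F assume F: "F \<in> facets d (antiprism K)"
  show "crumpling ` F \<in> facets d K"
    by (rule crumpling_facet(1)[OF assms(1,3) F])
  show "perm_group_iso F (projectivities d (antiprism K) F)
          (crumpling ` F) (projectivities d K (crumpling ` F))
          crumpling (induced_map crumpling F)"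
    by (rule crumpling_perm_group_iso[OF assms(1,3) F])
qed (use assms antiprism_abstract_complex antiprism_locally_finite antiprism_pure
      antiprism_strongly_connected in blast)+

end
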